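(* Every bounded polynomial integer sequence is of one of the following forms, for some $\varepsilon\in\{1,-1\}$ and some integers $S,R$: (1) $S,S,S,S,S,\ldots$ (constant); (2) $R,S,S,S,S,\ldots$ (constantly $S$ from the second term on); (3) $S+\varepsilon,\,S+2\varepsilon,\,S,S,S,\ldots$ (constantly $S$ from the third term on); (4) $S+2\varepsilon,\,S+4\varepsilon,\,S,S,S,\ldots$ (constantly $S$ from the third term on); (5) $S,R,S,R,S,\ldots$ (alternating between $S$ and $R$); (6) $S+\varepsilon,\,S,R,S,R,\ldots$ (alternating between $S$ and $R$ from the second term on), where $R-S\neq\varepsilon$; (7) $S+2\varepsilon,\,S+\varepsilon,\,S,\,S+3\varepsilon,\,S,\ldots$ (alternating between $S$ and $S+3\varepsilon$ from the third term on).
   Context: For $u\in\mathbb{Z}[x]$ and a positive integer $n$, $u^{(n)}$ denotes the $n$-fold composition $u\circ\cdots\circ u$. An integer sequence $\{r_n\}_{n\ge 0}$ is a polynomial (integer) sequence if there is $u\in\mathbb{Z}[x]$ with $u^{(n)}(r_0)=r_n$ for all $n\ge 1$. *)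

theory Defs
  imports "HOL-Analysis.Elementary_Metric_Spaces" "HOL-Computational_Algebra.Polynomial"
begin

text \<open>The \<open>n\<close>-fold composition \<open>u \<circ> \<cdots> \<circ> u\<close> in \<open>\<int>[x]\<close>, extended by the
  identity polynomial \<open>x\<close> for \<open>n = 0\<close>.\<close>

definition poly_iter :: "int poly \<Rightarrow> nat \<Rightarrow> int poly"
  where "poly_iter u n = ((\<lambda>v. u \<circ>\<^sub>p v) ^^ n) [:0, 1:]"

definition polynomial_sequence :: "(nat \<Rightarrow> int) \<Rightarrow> bool"
  where "polynomial_sequence r \<longleftrightarrow> (\<exists>u :: int poly. \<forall>n\<ge>1. poly (poly_iter u n) (r 0) = r n)"

end

theory Submission
  imports Defs
begin

text \<open>Since \<open>a - b\<close> divides \<open>u(a) - u(b)\<close>, each difference of consecutive terms divides the next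
  one. In a bounded sequence the differences therefore either reach zero or have eventually constant
  absolute value, in which case two consecutive ones are opposite; either way \<open>r (n + 2) = r n\<close>
  for some \<open>n\<close>. The preperiod leading to a fixed point or a 2-cycle is restricted by the same
  divisibility and by its second-order version, obtained from the quotient
  \<open>(u(x) - u(c)) / (x - c)\<close>, which again has integer coefficients.\<close>

lemma poly_iter_Suc: "poly (poly_iter u (Suc n)) x = poly u (poly (poly_iter u n) x)"
  by (simp add: poly_iter_def poly_pcompose)

lemma polynomial_sequenceE:
  assumes "polynomial_sequence r"
  obtains u where "\<And>n. poly u (r n) = r (Suc n)"
proof -
  obtain u where u: "\<And>n. n \<ge> 1 \<Longrightarrow> poly (poly_iter u n) (r 0) = r n"
    using assms unfolding polynomial_sequence_def by blast
  have "poly (poly_iter u n) (r 0) = r n" for n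
    \<comment> \<open>The definition speaks only of n at least 1; n = 0 is added through the
      identity polynomial, so that \<open>r\<close> is a full orbit from its first term on.\<close>
    using u[of n] by (cases "n = 0") (simp_all add: poly_iter_def)
  then have "poly u (r n) = r (Suc n)" for n
    by (metis poly_iter_Suc)
  then show thesis by (rule that)
qed

lemma poly_divided_difference:
  fixes u :: "'a::comm_ring_1 poly"
  obtains v where "\<And>x. poly u x - poly u c = (x - c) * poly v x"
proof -
  have "poly (u - [:poly u c:]) c = 0" by simp
  then obtain v where "u - [:poly u c:] = [:-c, 1:] * v"
    by (metis dvdE poly_eq_0_iff_dvd)
  then have "poly (u - [:poly u c:]) x = poly ([:-c, 1:] * v) x" for x by simp
  then show thesis using that[of v] by (simp add: algebra_simps)
qed

lemma diff_dvd_poly_diff: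
  fixes u :: "'a::comm_ring_1 poly"
  shows "a - b dvd poly u a - poly u b"
  by (metis dvd_triv_left poly_divided_difference)

text \<open>Meant for the offsets x, y of two successive orbit points from a fixed point. With y = c
  x, the second divisibility makes c - 1 a unit, and c = 0 is excluded.\<close>

lemma eq_double_if_dvd:
  fixes x y :: int
  assumes "x dvd y" "y - x dvd y" "y \<noteq> 0"
  shows "y = 2 * x"
proof -
  obtain c where c: "y = x * c" using assms(1) by (rule dvdE)
  have "x \<noteq> 0" using c assms(3) by auto
  moreover have "x * (c - 1) dvd x * c" using assms(2) c by (simp add: algebra_simps)
  ultimately have "c - 1 dvd c" by simp
  then have "c - 1 dvd 1" by (metis diff_add_cancel dvd_add_right_iff dvd_refl)
  then have "c = 2 \<or> c = 0" by (auto simp: zdvd1_eq)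
  then show ?thesis using c assms(3) by auto
qed

lemma int_dvd_2_cases:
  fixes x :: int
  assumes "x dvd 2"
  shows "x \<in> {1, -1, 2, -2}"
proof -
  have "\<bar>x\<bar> \<le> 2" using zdvd_imp_le[of "\<bar>x\<bar>" 2] assms by simp
  moreover have "x \<noteq> 0" using assms by auto
  ultimately show ?thesis by auto
qed

lemma preperiod_two_fixed_point:
  fixes u :: "int poly"
  assumes "poly u a = b" "poly u b = S" "poly u S = S" "b \<noteq> S"
  shows "b - S = 2 * (a - S)" "a - S \<in> {1, -1, 2, -2}"
proof -
  have "a - S dvd b - S" using diff_dvd_poly_diff[of a S u] assms by simp
  moreover have "(b - S) - (a - S) dvd b - S"
    using diff_dvd_poly_diff[of b a u] dvd_diff_commute[of "b - a" S b] assms by simp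
  ultimately show eq: "b - S = 2 * (a - S)" by (rule eq_double_if_dvd) (use assms in simp)
  \<comment> \<open>The quotient \<open>v\<close> takes the value 2 at a and 0 at b, so b - a
    divides 2; by the doubling, b - a is also the offset a - S.\<close>
  obtain v where v: "\<And>x. poly u x - poly u S = (x - S) * poly v x"
    using poly_divided_difference[of u S] by blast
  have "(a - S) * poly v a = (a - S) * 2" using v[of a] eq assms by simp
  then have va: "poly v a = 2" using eq assms(4) unfolding mult_cancel_left by auto
  have "poly v b = 0" using v[of b] assms by simp
  moreover have "b - a dvd poly v b - poly v a" by (rule diff_dvd_poly_diff)
  moreover have "b - a = a - S" using eq by simp
  ultimately have "a - S dvd 2" using va by simp
  then show "a - S \<in> {1, -1, 2, -2}" by (rule int_dvd_2_cases)
qed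

text \<open>Otherwise the offsets of a, b, c from S double twice, being t, 2t, 4t. Then c - a = 3t
  would have to divide u(c) - u(a) = -2t.\<close>

lemma no_preperiod_three_fixed_point:
  fixes u :: "int poly"
  assumes "poly u a = b" "poly u b = c" "poly u c = S" "poly u S = S"
  shows "c = S"
proof (rule ccontr)
  assume "c \<noteq> S"
  then have c: "c - S = 2 * (b - S)" using preperiod_two_fixed_point assms(2-4) by blast
  then have "b \<noteq> S" using \<open>c \<noteq> S\<close> by auto
  have "a - S dvd b - S" using diff_dvd_poly_diff[of a S u] assms by simp
  moreover have "c - b = b - S" using c by simp
  then have "(b - S) - (a - S) dvd b - S" using diff_dvd_poly_diff[of b a u] assms by simp
  ultimately have b: "b - S = 2 * (a - S)" by (rule eq_double_if_dvd) (use \<open>b \<noteq> S\<close> in simp)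
  have "c - a dvd S - b" using diff_dvd_poly_diff[of c a u] assms by simp
  moreover have "c - a = (a - S) * 3" "S - b = (a - S) * (-2)" using b c by simp_all
  ultimately have "(a - S) * 3 dvd (a - S) * (-2)" by simp
  moreover have "a - S \<noteq> 0" using b \<open>b \<noteq> S\<close> by auto
  ultimately have "3 dvd (-2 :: int)" using dvd_mult_cancel_left by blast
  then show False by simp
qed

text \<open>The quotient of u(x) - u(R) by x - R vanishes at a, where u agrees with u(R), and equals
  -1 at S, where the cycle swaps S and R. Hence a - S divides 1.\<close>

lemma preperiod_one_two_cycle:
  fixes u :: "int poly"
  assumes "poly u a = S" "poly u S = R" "poly u R = S" "a \<noteq> R" "S \<noteq> R"
  shows "a - S \<in> {1, -1}"
proof -
  obtain v where v: "\<And>x. poly u x - poly u R = (x - R) * poly v x"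
    using poly_divided_difference[of u R] by blast
  have "poly v a = 0" using v[of a] assms by simp
  moreover have "(S - R) * poly v S = (S - R) * (-1)" using v[of S] assms by simp
  then have "poly v S = -1" using assms(5) unfolding mult_cancel_left by simp
  ultimately have "a - S dvd 1" using diff_dvd_poly_diff[of a S v] by simp
  then show ?thesis by (auto simp: zdvd1_eq)
qed

text \<open>Both a and R are at distance 1 from b, since b - a and b - R divide the unit a - S. With
  b distinct from S and a from R, the points S, a, b, R are then equally spaced.\<close>

lemma preperiod_two_two_cycle:
  fixes u :: "int poly"
  assumes "poly u b = a" "poly u a = S" "poly u S = R" "poly u R = S"
    and "a \<noteq> R" "S \<noteq> R" "b \<noteq> S"
  shows "a - S \<in> {1, -1}" "b - S = 2 * (a - S)" "R - S = 3 * (a - S)"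
proof -
  show a: "a - S \<in> {1, -1}" using preperiod_one_two_cycle assms by blast
  have "b - a dvd a - S" using diff_dvd_poly_diff[of b a u] assms by simp
  moreover have "b - R dvd a - S" using diff_dvd_poly_diff[of b R u] assms by simp
  ultimately have "\<bar>b - a\<bar> = 1" "\<bar>b - R\<bar> = 1" using a by (auto simp: zdvd1_eq)
  then show "b - S = 2 * (a - S)" "R - S = 3 * (a - S)"
    using a assms(5-7) by auto
qed

text \<open>The point c would be a neighbour of b, hence a or R; c = R would give b = u(R) =
  S.\<close>

lemma no_preperiod_three_two_cycle:
  fixes u :: "int poly"
  assumes "poly u c = b" "poly u b = a" "poly u a = S" "poly u S = R" "poly u R = S"
    and "a \<noteq> R" "S \<noteq> R" "b \<noteq> S" "c \<noteq> a"
  shows False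
proof -
  note * = preperiod_two_two_cycle[OF assms(2-8)]
  have "c - b dvd b - a" using diff_dvd_poly_diff[of c b u] assms by simp
  moreover have "b - a = a - S" using * by simp
  ultimately have "\<bar>c - b\<bar> = 1" using *(1) by (auto simp: zdvd1_eq)
  then have "c = R" using * \<open>c \<noteq> a\<close> by auto
  then have "b = S" using assms by simp
  then show False using assms(8) by simp
qed

lemma bounded_mono_abs_eventually_const:
  fixes d :: "nat \<Rightarrow> int"
  assumes mono: "\<And>n. \<bar>d n\<bar> \<le> \<bar>d (Suc n)\<bar>" and le: "\<And>n. \<bar>d n\<bar> \<le> B"
  obtains N where "\<And>n. n \<ge> N \<Longrightarrow> \<bar>d n\<bar> = \<bar>d N\<bar>"
proof -
  \<comment> \<open>The gap between |d n| and its bound is a natural number that never grows, so it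
    stays constant once minimal.\<close>
  define N where "N = arg_min (\<lambda>n. nat (B - \<bar>d n\<bar>)) (\<lambda>_. True)"
  have min: "nat (B - \<bar>d N\<bar>) \<le> nat (B - \<bar>d n\<bar>)" for n
    unfolding N_def by (rule arg_min_nat_le) simp
  have "\<bar>d n\<bar> = \<bar>d N\<bar>" if "n \<ge> N" for n
  proof -
    have "\<bar>d N\<bar> \<le> \<bar>d n\<bar>" using lift_Suc_mono_le[of "\<lambda>n. \<bar>d n\<bar>"] mono that by blast
    then show ?thesis using min[of n] le[of n] by linarith
  qed
  then show thesis by (rule that)
qed

lemma bounded_polynomial_orbit_eventually_two_periodic:
  fixes r :: "nat \<Rightarrow> int"
  assumes step: "\<And>n. poly u (r n) = r (Suc n)" and B: "\<And>n. \<bar>r n\<bar> \<le> B"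
  shows "\<exists>n. r (Suc (Suc n)) = r n"
proof (rule ccontr)
  assume "\<nexists>n. r (Suc (Suc n)) = r n"
  then have no: "r (Suc (Suc n)) \<noteq> r n" for n by blast
  define d where "d n = r (Suc n) - r n" for n
  have d_dvd: "d n dvd d (Suc n)" for n
    using diff_dvd_poly_diff[of "r (Suc n)" "r n" u] by (simp add: d_def step)
  have d_nz: "d n \<noteq> 0" for n
  proof
    assume "d n = 0"
    then have "r (Suc n) = r n" by (simp add: d_def)
    then show False using no[of n] step by metis
  qed
  have mono: "\<bar>d n\<bar> \<le> \<bar>d (Suc n)\<bar>" for n using dvd_imp_le_int[OF d_nz d_dvd] .
  have "\<bar>d n\<bar> \<le> 2 * B" for n using B[of n] B[of "Suc n"] by (simp add: d_def)
  with mono obtain N where N: "\<And>n. n \<ge> N \<Longrightarrow> \<bar>d n\<bar> = \<bar>d N\<bar>"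
    using bounded_mono_abs_eventually_const by blast
  have d_const: "d (N + j) = d N" for j
  proof (induction j)
    case (Suc j)
    \<comment> \<open>Opposite consecutive differences would cancel and bring the orbit back after
      two steps.\<close>
    have "d (Suc (N + j)) \<noteq> - d (N + j)" using no[of "N + j"] by (simp add: d_def)
    moreover have "\<bar>d (Suc (N + j))\<bar> = \<bar>d (N + j)\<bar>" using N[of "N + j"] N[of "Suc (N + j)"] by simp
    ultimately show ?case using Suc by (simp add: abs_eq_iff)
  qed simp
  have r_eq: "r (N + j) = r N + int j * d N" for j
  proof (induction j)
    case (Suc j)
    have "r (N + Suc j) = r (N + j) + d (N + j)" by (simp add: d_def)
    then show ?case using Suc d_const by (simp add: algebra_simps)
  qed simp
  \<comment> \<open>Two terms differ by at most 2B, but after 2B + 1 steps of a non-zero arithmetic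
    progression they differ by more.\<close>
  define j where "j = nat (2 * B + 1)"
  have "int j \<le> \<bar>int j * d N\<bar>"
    using mult_left_mono[of 1 "\<bar>d N\<bar>" "int j"] d_nz[of N] by (simp add: abs_mult)
  also have "\<dots> \<le> 2 * B" using r_eq[of j] B[of "N + j"] B[of N] by linarith
  finally show False using B[of 0] by (simp add: j_def)
qed

lemma two_periodic_from:
  assumes step: "\<And>n. f (r n) = r (Suc n)" and k: "r (Suc (Suc k)) = r k"
  shows "r (k + j) = (if even j then r k else r (Suc k))"
proof (induction j)
  case (Suc j)
  then show ?case using step k by (metis add_Suc_right even_Suc)
qed simp

theorem corollary4p11:
  fixes r :: "nat \<Rightarrow> int"
  assumes "polynomial_sequence r"
    and "bounded (range (\<lambda>n. real_of_int (r n)))"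
  shows "\<exists>\<epsilon>\<in>{1, -1 :: int}. \<exists>S R :: int.
      (\<forall>n. r n = S)
    \<or> (r 0 = R \<and> (\<forall>n\<ge>1. r n = S))
    \<or> (r 0 = S + \<epsilon> \<and> r 1 = S + 2 * \<epsilon> \<and> (\<forall>n\<ge>2. r n = S))
    \<or> (r 0 = S + 2 * \<epsilon> \<and> r 1 = S + 4 * \<epsilon> \<and> (\<forall>n\<ge>2. r n = S))
    \<or> (\<forall>n. r n = (if even n then S else R))
    \<or> (r 0 = S + \<epsilon> \<and> (\<forall>n\<ge>1. r n = (if odd n then S else R)) \<and> R - S \<noteq> \<epsilon>)
    \<or> (r 0 = S + 2 * \<epsilon> \<and> r 1 = S + \<epsilon> \<and> (\<forall>n\<ge>2. r n = (if even n then S else S + 3 * \<epsilon>)))"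
    (is "\<exists>\<epsilon>\<in>_. \<exists>S R. ?Q \<epsilon> S R")
proof -
  obtain u where step: "\<And>n. poly u (r n) = r (Suc n)"
    using assms(1) polynomial_sequenceE by blast
  obtain B :: real where B: "\<And>n. \<bar>real_of_int (r n)\<bar> \<le> B"
    using assms(2) unfolding bounded_iff by auto
  have "\<bar>r n\<bar> \<le> \<lceil>B\<rceil>" for n using B[of n] by linarith
  then have ex: "\<exists>n. r (Suc (Suc n)) = r n"
    using bounded_polynomial_orbit_eventually_two_periodic[where r = r and u = u, OF step] by blast
  \<comment> \<open>k is the preperiod length; its minimality supplies the inequalities that the
    preperiod lemmas require. A fixed point is the case S = R.\<close>
  define k where "k = (LEAST n. r (Suc (Suc n)) = r n)"
  define S R where "S = r k" and "R = r (Suc k)"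
  have k: "r (Suc (Suc k)) = r k" unfolding k_def using ex by (rule LeastI_ex)
  have least: "r (Suc (Suc n)) \<noteq> r n" if "n < k" for n
    using that unfolding k_def by (rule not_less_Least)
  have tail: "r n = (if even (n - k) then S else R)" if "n \<ge> k" for n
    using two_periodic_from[where r = r and k = k and j = "n - k", OF step k] that
    by (simp add: S_def R_def)
  have uS: "poly u S = R" and uR: "poly u R = S" using step k by (simp_all add: S_def R_def)
  consider "k = 0" | "k = 1" | "k = 2" | m where "k = Suc (Suc (Suc m))"
    by (metis One_nat_def Suc_1 not0_implies_Suc)
  then show ?thesis
  proof cases
    case 1
    \<comment> \<open>The alternating form also covers the constant sequence, with S = R.\<close>
    then have "?Q 1 S R" using tail by simp
    then show ?thesis by blast
  next
    case 2
    have 0: "r 0 \<noteq> R" using least[of 0] 2 by (simp add: R_def)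
    have tl: "\<forall>n\<ge>1. r n = (if odd n then S else R)" using tail 2 by auto
    show ?thesis
    proof (cases "S = R")
      case True
      \<comment> \<open>The free first term takes the place of R in the second form; the sign is
        arbitrary.\<close>
      then have "?Q 1 S (r 0)" using tl by simp
      then show ?thesis by blast
    next
      case False
      have "poly u (r 0) = S" using step[of 0] 2 by (simp add: S_def)
      then have "r 0 - S \<in> {1, -1}" using preperiod_one_two_cycle uS uR 0 False by blast
      \<comment> \<open>For this sign, the side condition on R - S says that \<open>r 0\<close>
        differs from R.\<close>
      moreover have "?Q (r 0 - S) S R" using tl 0 by simp
      ultimately show ?thesis by blast
    qed
  next
    case 3
    have 1: "r 1 \<noteq> R" using least[of 1] 3 by (simp add: R_def numeral_2_eq_2)
    have 0: "r 0 \<noteq> S" using least[of 0] 3 by (simp add: S_def numeral_2_eq_2)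
    have u: "poly u (r 0) = r 1" "poly u (r 1) = S"
      using step[of 0] step[of 1] 3 by (simp_all add: S_def numeral_2_eq_2)
    have tl: "\<forall>n\<ge>2. r n = (if even n then S else R)" using tail 3 by auto
    show ?thesis
    proof (cases "S = R")
      case True
      with u 1 uS have eq: "r 1 - S = 2 * (r 0 - S)" and d: "r 0 - S \<in> {1, -1, 2, -2}"
        using preperiod_two_fixed_point[of u "r 0" "r 1" S] by auto
      \<comment> \<open>An offset of absolute value 1 gives the third form, one of absolute value 2
        the fourth.\<close>
      consider "r 0 - S \<in> {1, -1}" | e where "e \<in> {1, -1}" "r 0 - S = 2 * e"
        using d that(1) that(2)[of 1] that(2)[of "-1"] by auto
      then show ?thesis
      proof cases
        case 1
        moreover have "?Q (r 0 - S) S R" using eq True tl by simp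
        ultimately show ?thesis by blast
      next
        case (2 e)
        then have "r 0 = S + 2 * e" "r 1 = S + 4 * e" using eq by simp_all
        then have "?Q e S R" using True tl by simp
        with 2 show ?thesis by blast
      qed
    next
      case False
      note * = preperiod_two_two_cycle[OF u uS uR 1 False 0]
      have R: "R = S + 3 * (r 1 - S)" using *(3) by simp
      have "\<forall>n\<ge>2. r n = (if even n then S else S + 3 * (r 1 - S))"
        using tl unfolding R[symmetric] .
      then have "?Q (r 1 - S) S R" using *(2) by simp
      with *(1) show ?thesis by blast
    qed
  next
    case (4 m)
    have u: "poly u (r m) = r (Suc m)" "poly u (r (Suc m)) = r (Suc (Suc m))"
      "poly u (r (Suc (Suc m))) = S"
      using step 4 by (simp_all add: S_def)
    \<comment> \<open>Only the last three terms before the cycle are examined, so all preperiods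
      longer than two are excluded at once.\<close>
    have ne: "r (Suc (Suc m)) \<noteq> R" "r (Suc m) \<noteq> S" "r m \<noteq> r (Suc (Suc m))"
      using least[of "Suc (Suc m)"] least[of "Suc m"] least[of m] 4
      by (auto simp: S_def R_def)
    show ?thesis
    proof (cases "S = R")
      case True
      then show ?thesis using no_preperiod_three_fixed_point[OF u] uS ne by simp
    next
      case False
      then show ?thesis using no_preperiod_three_two_cycle[OF u uS uR] ne by blast
    qed
  qed
qed

end
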